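(* Let $\mathbf P=(P,+,\bar{}\,,\tilde{}\,,0,1)$ be a good monotonous pseudoeffect algebra with induced order $\leq$ and define, for $x,y\in P$, $x\odot y:=\widetilde{\bar x+\bar y}$, defined if and only if $\tilde x\leq y$; $x\rightarrow y:=\bar x+L(x,y)=\{\bar x+u\mid u\in L(x,y)\}$; $x\leadsto y:=L(x,y)+\tilde x=\{u+\tilde x\mid u\in L(x,y)\}$. Then $(P,\leq,\odot,\rightarrow,\leadsto,\bar{}\,,\tilde{}\,,0,1)$ is a divisible unsharp residuated poset.
   Context: A pseudoeffect algebra is a partial algebra $(P,+,\bar{}\,,\tilde{}\,,0,1)$ of type $(2,1,1,0,0)$ where $(P,\bar{}\,,\tilde{}\,,0,1)$ is an algebra and $+$ is a partial binary operation such that for all $x,y,z\in P$: (P1) if $x+y$ is defined then there exist $u,w\in P$ with $u+x=y+w=x+y$; (P2) $(x+y)+z$ is defined iff $x+(y+z)$ is defined, and then they are equal; (P3) $\bar x$ is the unique $u$ with $u+x=1$ and $\tilde x$ is the unique $w$ with $x+w=1$; (P4) if $1+x$ or $x+1$ is defined then $x=0$. The induced order is $x\leq y$ iff there is $z$ with $x+z=y$; it makes $P$ a bounded poset. We write $\widetilde{t}$ and $\overline{t}$ for the unary operations applied to a term $t$. For a poset and $A\subseteq P$: $L(A)=\{x\mid x\leq y\ \forall y\in A\}$, $U(A)=\{x\mid y\leq x\ \forall y\in A\}$; $L(a,b)=L(\{a,b\})$, $U(a,b)=U(\{a,b\})$, $LU(A)=L(U(A))$, $UL(a,b)=U(L(\{a,b\}))$.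 For subsets $A,B$, $A\leq B$ means $x\leq y$ for all $x\in A,y\in B$ (similarly with single elements). Operations are extended elementwise to subsets, e.g. $x+A=\{x+y\mid y\in A\}$, $A+x=\{y+x\mid y\in A\}$, $A\odot y=\{u\odot y\mid u\in A\}$, $y\odot A=\{y\odot u\mid u\in A\}$. $\mathbf P$ is good if $\widetilde{\bar x+\bar y}=\overline{\tilde x+\tilde y}$ for all $x,y\in P$ with $\tilde x\leq y$. $\mathbf P$ is monotonous if for all $x\in P$ and non-empty $A,B\subseteq P$: $A\cup B\leq\bar x$ and $L(A)\leq U(B)$ imply $L(A+x)\leq U(B+x)$; and $A\cup B\leq\tilde x$ and $L(A)\leq U(B)$ imply $L(x+A)\leq U(x+B)$. A partial monoid $(R,\odot,1)$ is a set with a partial binary operation such that $(x\odot y)\odot z$ is defined iff $x\odot(y\odot z)$ is defined and then they are equal, and $x\odot1=1\odot x=x$. An unsharp residuated poset is a tuple $(R,\leq,\odot,\rightarrow,\leadsto,\bar{}\,,\tilde{}\,,0,1)$ with $\rightarrow,\leadsto:R^2\to 2^R$ and unary operations $\bar{}\,,\tilde{}$ such that for all $x,y,z\in R$: (R1) $(R,\leq,0,1)$ is a bounded poset; (R2) $\tilde{\bar x}=\bar{\tilde x}=x$, and $x\leq y$ implies $\bar y\leq\bar x$ and $\tilde y\leq\tilde x$; (R3) $(R,\odot,1)$ is a partial monoid where $x\odot y$ is defined iff $\tilde x\leq y$, and $\bar z\leq x\leq y$ implies $x\odot z\leq y\odot z$, and $\tilde z\leq x\leq y$ implies $z\odot x\leq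 z\odot y$; (R4) $L(U(x,\bar y)\odot y)\leq UL(y,z)$ iff $LU(x,\bar y)\leq U(y\rightarrow z)$; (R5) $L(y\odot U(x,\tilde y))\leq UL(y,z)$ iff $LU(x,\tilde y)\leq U(y\leadsto z)$; (R6) $x\rightarrow0=\{\bar x\}$ and $x\leadsto 0=\{\tilde x\}$; (R7) $\widetilde{\bar x\odot\bar y}=\overline{\tilde x\odot\tilde y}$. It is divisible if $x\leq y$ implies $(y\rightarrow x)\odot y=y\odot(y\leadsto x)=L(x)$. *)

theory Defs
  imports Main
begin

text \<open>Algebras are carried by a whole type. A partial binary operation is a function into
  \<^typ>\<open>'a option\<close>, with \<^const>\<open>None\<close> for undefined.\<close>

type_synonym 'a pop = "'a \<Rightarrow> 'a \<Rightarrow> 'a option"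

definition lower :: "('a \<Rightarrow> 'a \<Rightarrow> bool) \<Rightarrow> 'a set \<Rightarrow> 'a set" where
  "lower le A = {x. \<forall>y\<in>A. le x y}"

definition upper :: "('a \<Rightarrow> 'a \<Rightarrow> bool) \<Rightarrow> 'a set \<Rightarrow> 'a set" where
  "upper le A = {x. \<forall>y\<in>A. le y x}"

definition set_le :: "('a \<Rightarrow> 'a \<Rightarrow> bool) \<Rightarrow> 'a set \<Rightarrow> 'a set \<Rightarrow> bool" where
  "set_le le A B \<longleftrightarrow> (\<forall>x\<in>A. \<forall>y\<in>B. le x y)"

text \<open>Elementwise extension of a partial operation to a set on the left or on the right.
  Undefined values contribute nothing; wherever these sets are used below, either every value is
  defined because of the surrounding axioms, or definedness is demanded explicitly.\<close>

definition set_op_left :: "'a pop \<Rightarrow> 'a set \<Rightarrow> 'a \<Rightarrow> 'a set" where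
  "set_op_left f A x = {z. \<exists>y\<in>A. f y x = Some z}"

definition set_op_right :: "'a pop \<Rightarrow> 'a \<Rightarrow> 'a set \<Rightarrow> 'a set" where
  "set_op_right f x A = {z. \<exists>y\<in>A. f x y = Some z}"

text \<open>Equality of two \<^const>\<open>Option.bind\<close> terms, as in the associativity laws below, says that
  one side is defined iff the other one is, and that they are then equal.\<close>

locale pseudoeffect_algebra =
  fixes padd :: "'a pop"
    and bar tilde :: "'a \<Rightarrow> 'a"
    and zero one :: 'a
  assumes P1: "padd x y = Some s \<Longrightarrow> \<exists>u w. padd u x = Some s \<and> padd y w = Some s"
    and P2: "Option.bind (padd x y) (\<lambda>s. padd s z) = Option.bind (padd y z) (\<lambda>t. padd x t)"
    and P3_bar: "padd u x = Some one \<longleftrightarrow> u = bar x"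
    and P3_tilde: "padd x w = Some one \<longleftrightarrow> w = tilde x"
    and P4: "padd one x \<noteq> None \<or> padd x one \<noteq> None \<Longrightarrow> x = zero"

definition induced_le :: "'a pop \<Rightarrow> 'a \<Rightarrow> 'a \<Rightarrow> bool" where
  "induced_le padd x y \<longleftrightarrow> (\<exists>z. padd x z = Some y)"

definition good :: "'a pop \<Rightarrow> ('a \<Rightarrow> 'a) \<Rightarrow> ('a \<Rightarrow> 'a) \<Rightarrow> bool" where
  "good padd bar tilde \<longleftrightarrow>
    (\<forall>x y. induced_le padd (tilde x) y \<longrightarrow>
      map_option tilde (padd (bar x) (bar y)) = map_option bar (padd (tilde x) (tilde y)))"

definition monotonous :: "'a pop \<Rightarrow> ('a \<Rightarrow> 'a) \<Rightarrow> ('a \<Rightarrow> 'a) \<Rightarrow> bool" where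
  "monotonous padd bar tilde \<longleftrightarrow>
    (let le = induced_le padd; L = lower le; U = upper le in
      \<forall>x A B. A \<noteq> {} \<longrightarrow> B \<noteq> {} \<longrightarrow>
        (set_le le (A \<union> B) {bar x} \<and> set_le le (L A) (U B) \<longrightarrow>
           set_le le (L (set_op_left padd A x)) (U (set_op_left padd B x))) \<and>
        (set_le le (A \<union> B) {tilde x} \<and> set_le le (L A) (U B) \<longrightarrow>
           set_le le (L (set_op_right padd x A)) (U (set_op_right padd x B))))"

locale partial_monoid =
  fixes odot :: "'a pop" and one :: 'a
  assumes assoc:
      "Option.bind (odot x y) (\<lambda>s. odot s z) = Option.bind (odot y z) (\<lambda>t. odot x t)"
    and right_unit: "odot x one = Some x"
    and left_unit: "odot one x = Some x"

text \<open>In \<open>R7\<close>, equality of the two options includes that both sides are defined for the same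
  arguments; this is already forced by \<open>R2\<close> and \<open>R3_defined\<close>.\<close>

locale unsharp_residuated_poset =
  fixes le :: "'a \<Rightarrow> 'a \<Rightarrow> bool"
    and odot :: "'a pop"
    and imp limp :: "'a \<Rightarrow> 'a \<Rightarrow> 'a set"
    and bar tilde :: "'a \<Rightarrow> 'a"
    and zero one :: 'a
  assumes R1_poset: "reflp le" "antisymp le" "transp le"
    and R1_bounded: "le zero x" "le x one"
    and R2_inverse: "tilde (bar x) = x" "bar (tilde x) = x"
    and R2_antitone: "le x y \<Longrightarrow> le (bar y) (bar x)" "le x y \<Longrightarrow> le (tilde y) (tilde x)"
    and R3_monoid: "partial_monoid odot one"
    and R3_defined: "odot x y \<noteq> None \<longleftrightarrow> le (tilde x) y"
    and R3_mono_left: "le (bar z) x \<Longrightarrow> le x y \<Longrightarrow>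
      \<exists>u v. odot x z = Some u \<and> odot y z = Some v \<and> le u v"
    and R3_mono_right: "le (tilde z) x \<Longrightarrow> le x y \<Longrightarrow>
      \<exists>u v. odot z x = Some u \<and> odot z y = Some v \<and> le u v"
    and R4: "set_le le (lower le (set_op_left odot (upper le {x, bar y}) y))
                       (upper le (lower le {y, z})) \<longleftrightarrow>
             set_le le (lower le (upper le {x, bar y})) (upper le (imp y z))"
    and R5: "set_le le (lower le (set_op_right odot y (upper le {x, tilde y})))
                       (upper le (lower le {y, z})) \<longleftrightarrow>
             set_le le (lower le (upper le {x, tilde y})) (upper le (limp y z))"
    and R6: "imp x zero = {bar x}" "limp x zero = {tilde x}"
    and R7: "map_option tilde (odot (bar x) (bar y)) = map_option bar (odot (tilde x) (tilde y))"

locale divisible_unsharp_residuated_poset = unsharp_residuated_poset +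
  assumes divisible_defined: "le x y \<Longrightarrow> u \<in> imp y x \<Longrightarrow> odot u y \<noteq> None"
      "le x y \<Longrightarrow> u \<in> limp y x \<Longrightarrow> odot y u \<noteq> None"
    and divisible: "le x y \<Longrightarrow> set_op_left odot (imp y x) y = lower le {x}"
      "le x y \<Longrightarrow> set_op_right odot y (limp y x) = lower le {x}"

definition pea_odot :: "'a pop \<Rightarrow> ('a \<Rightarrow> 'a) \<Rightarrow> ('a \<Rightarrow> 'a) \<Rightarrow> 'a pop" where
  "pea_odot padd bar tilde x y =
    (if induced_le padd (tilde x) y then map_option tilde (padd (bar x) (bar y)) else None)"

definition pea_imp :: "'a pop \<Rightarrow> ('a \<Rightarrow> 'a) \<Rightarrow> 'a \<Rightarrow> 'a \<Rightarrow> 'a set" where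
  "pea_imp padd bar x y = set_op_right padd (bar x) (lower (induced_le padd) {x, y})"

definition pea_limp :: "'a pop \<Rightarrow> ('a \<Rightarrow> 'a) \<Rightarrow> 'a \<Rightarrow> 'a \<Rightarrow> 'a set" where
  "pea_limp padd tilde x y = set_op_left padd (lower (induced_le padd) {x, y}) (tilde x)"

end

theory Submission
  imports Defs
begin

text \<open>Two facts carry the proof. First, \<open>v \<mapsto> bar y + v\<close> and \<open>u \<mapsto> u \<odot> y\<close> are mutually inverse
  bijections between \<open>[0, y]\<close> and \<open>[bar y, 1]\<close>; this gives divisibility at once. Secondly,
  transporting \<open>L A \<le> U B\<close> along the first bijection is monotonicity itself, and along the second
  one it is monotonicity applied to \<open>bar ` B\<close> and \<open>bar ` A\<close>, because \<open>bar\<close> and \<open>tilde\<close> are antitone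
  bijections. The two transports are the two directions of \<open>R4\<close>. Goodness makes the
  hypotheses invariant under reversing the addition and exchanging \<open>bar\<close> with \<open>tilde\<close>,
  which turns \<open>R4\<close> into \<open>R5\<close>.\<close>

context pseudoeffect_algebra
begin

abbreviation le (infix "\<sqsubseteq>" 50) where "x \<sqsubseteq> y \<equiv> induced_le padd x y"

section \<open>Complements, the neutral element and cancellation\<close>

lemma bar_add: "padd (bar x) x = Some one"
  using P3_bar by simp

lemma add_tilde: "padd x (tilde x) = Some one"
  using P3_tilde by simp

lemma tilde_bar [simp]: "tilde (bar x) = x"
  using P3_tilde bar_add by metis

lemma bar_tilde [simp]: "bar (tilde x) = x"
  using P3_bar add_tilde by metis

lemma bar_one [simp]: "bar one = zero"
  using P4 bar_add by force

lemma tilde_one [simp]: "tilde one = zero"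
  using P4 add_tilde by force

lemma assocD1:
  assumes "padd x y = Some s" "padd s z = Some r"
  obtains t where "padd y z = Some t" "padd x t = Some r"
proof -
  have "Option.bind (padd y z) (padd x) = Some r"
    using P2[of x y z] assms by simp
  with that show thesis by (auto simp: bind_eq_Some_conv)
qed

lemma assocD2:
  assumes "padd y z = Some t" "padd x t = Some r"
  obtains s where "padd x y = Some s" "padd s z = Some r"
  using P2[of x y z] assms by (auto simp: bind_eq_Some_conv)

lemma add_zero: "padd x zero = Some x"
proof -
  \<comment> \<open>This reads (\<open>bar x\<close> + \<open>x\<close>) + \<open>zero\<close> =
    \<open>one\<close>; reassociated, it makes \<open>x\<close> + \<open>zero\<close> the
    \<open>tilde\<close> of \<open>bar x\<close>.\<close>
  have "padd one zero = Some one" by (metis add_tilde tilde_one)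
  with bar_add[of x] obtain t where "padd x zero = Some t" "padd (bar x) t = Some one"
    by (rule assocD1)
  then show ?thesis by (simp add: P3_tilde)
qed

lemma zero_add: "padd zero x = Some x"
proof -
  have "padd zero one = Some one" by (metis bar_add bar_one)
  with add_tilde[of x] obtain s where "padd zero x = Some s" "padd s (tilde x) = Some one"
    by (rule assocD2)
  then show ?thesis by (simp add: P3_bar)
qed

text \<open>\<open>P1\<close> moves the summand to the other side.\<close>

lemma le_iff: "x \<sqsubseteq> y \<longleftrightarrow> (\<exists>w. padd w x = Some y)"
  unfolding induced_le_def using P1 by blast

lemma add_cancel_left:
  assumes "padd x y = Some s" "padd x z = Some s"
  shows "y = z"
proof -
  \<comment> \<open>Adding \<open>bar s\<close> on the left turns \<open>y\<close> and
    \<open>z\<close> into right complements of the same element \<open>bar s\<close> +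
    \<open>x\<close>.\<close>
  have "padd (bar s) s = Some one" by (rule bar_add)
  with assms obtain r r' where "padd (bar s) x = Some r" "padd r y = Some one"
    "padd (bar s) x = Some r'" "padd r' z = Some one"
    by (metis assocD2)
  then show ?thesis by (simp add: P3_tilde)
qed

lemma add_eq_self: "padd x y = Some x \<Longrightarrow> y = zero"
  using add_cancel_left add_zero by blast

lemma add_eq_zero:
  assumes "padd x y = Some zero"
  shows "x = zero"
proof -
  \<comment> \<open>\<open>one\<close> + (\<open>x\<close> + \<open>y\<close>) is defined, hence so
    is \<open>one\<close> + \<open>x\<close>.\<close>
  obtain s where "padd one x = Some s" using assocD2[OF assms add_zero] by blast
  then show ?thesis by (simp add: P4)
qed

section \<open>The induced order and its antitone complements\<close>

lemma le_refl: "x \<sqsubseteq> x"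
  unfolding induced_le_def using add_zero by blast

lemma le_trans: "x \<sqsubseteq> y \<Longrightarrow> y \<sqsubseteq> z \<Longrightarrow> x \<sqsubseteq> z"
  unfolding induced_le_def by (metis assocD1)

lemma le_antisym:
  assumes "x \<sqsubseteq> y" "y \<sqsubseteq> x"
  shows "x = y"
proof -
  obtain a b where a: "padd x a = Some y" and b: "padd y b = Some x"
    using assms unfolding induced_le_def by blast
  \<comment> \<open>Ascending by \<open>a\<close> and then \<open>b\<close> returns to
    \<open>x\<close>, so \<open>a\<close> + \<open>b\<close> is zero, and with it
    \<open>a\<close>.\<close>
  from a b obtain t where "padd a b = Some t" "padd x t = Some x" by (rule assocD1)
  then have "a = zero" using add_eq_self add_eq_zero by blast
  with a add_zero show ?thesis by simp
qed

lemma zero_le: "zero \<sqsubseteq> x"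
  unfolding induced_le_def using zero_add by blast

lemma le_one: "x \<sqsubseteq> one"
  unfolding induced_le_def using add_tilde by blast

lemma bar_antitone:
  assumes "x \<sqsubseteq> y"
  shows "bar y \<sqsubseteq> bar x"
proof -
  obtain w where "padd w x = Some y" using assms le_iff by blast
  \<comment> \<open>Here \<open>s\<close> is a left complement of \<open>x\<close>, so
    \<open>w\<close> leads from \<open>bar y\<close> to \<open>bar x\<close>.\<close>
  then obtain s where "padd (bar y) w = Some s" "padd s x = Some one"
    using bar_add by (rule assocD2)
  then show ?thesis unfolding induced_le_def by (auto simp: P3_bar)
qed

lemma tilde_antitone:
  assumes "x \<sqsubseteq> y"
  shows "tilde y \<sqsubseteq> tilde x"
proof -
  obtain z where "padd x z = Some y" using assms unfolding induced_le_def by blast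
  then obtain t where "padd z (tilde y) = Some t" "padd x t = Some one"
    using add_tilde by (rule assocD1)
  then show ?thesis using le_iff by (auto simp: P3_tilde)
qed

lemma bar_le_iff: "bar x \<sqsubseteq> y \<longleftrightarrow> tilde y \<sqsubseteq> x"
  by (metis bar_antitone tilde_antitone bar_tilde tilde_bar)

lemma le_bar_iff: "x \<sqsubseteq> bar y \<longleftrightarrow> y \<sqsubseteq> tilde x"
  by (metis bar_antitone tilde_antitone bar_tilde tilde_bar)

text \<open>A sum \<open>s\<close> makes \<open>bar s\<close> + \<open>x\<close> the left complement
  of \<open>y\<close>; conversely, reassociating (\<open>u\<close> + \<open>x\<close>) +
  \<open>y\<close> = \<open>one\<close> forces \<open>x\<close> + \<open>y\<close> to exist.\<close>

lemma add_defined_iff: "padd x y \<noteq> None \<longleftrightarrow> x \<sqsubseteq> bar y"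
proof
  assume "padd x y \<noteq> None"
  then obtain s where "padd x y = Some s" by blast
  then obtain r where "padd (bar s) x = Some r" "padd r y = Some one"
    using bar_add by (rule assocD2)
  then show "x \<sqsubseteq> bar y" using le_iff by (auto simp: P3_bar)
next
  assume "x \<sqsubseteq> bar y"
  then obtain u where "padd u x = Some (bar y)" using le_iff by blast
  then obtain t where "padd x y = Some t" using bar_add by (rule assocD1)
  then show "padd x y \<noteq> None" by simp
qed

lemma add_mono_left:
  assumes "a \<sqsubseteq> b" "padd b c = Some t"
  obtains s where "padd a c = Some s" "s \<sqsubseteq> t"
proof -
  obtain u where "padd u a = Some b" using assms le_iff by blast
  then obtain s where "padd a c = Some s" "padd u s = Some t" using assms(2) by (rule assocD1)
  with that show ?thesis using le_iff by blast
qed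

section \<open>Left-right duality\<close>

lemma dual: "pseudoeffect_algebra (\<lambda>x y. padd y x) tilde bar zero one"
proof
  show "Option.bind (padd y x) (\<lambda>s. padd z s) = Option.bind (padd z y) (\<lambda>t. padd t x)" for x y z
    by (rule P2[symmetric])
qed (use P1 P3_bar P3_tilde P4 in blast)+

text \<open>Since the order is two-sided, facts about the reversed addition transfer without
  changing it.\<close>

lemma induced_le_dual: "induced_le (\<lambda>x y. padd y x) = induced_le padd"
  using le_iff by (auto simp: fun_eq_iff induced_le_def)

lemma add_mono_right:
  assumes "a \<sqsubseteq> b" "padd c b = Some t"
  obtains s where "padd c a = Some s" "s \<sqsubseteq> t"
  using pseudoeffect_algebra.add_mono_left[OF dual] assms unfolding induced_le_dual by metis

section \<open>The product as a complemented sum\<close>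

lemma pea_odot_eq: "pea_odot padd bar tilde x y = map_option tilde (padd (bar x) (bar y))"
proof (cases "tilde x \<sqsubseteq> y")
  case False
  \<comment> \<open>Where the guard of the product fails, the sum is undefined as well.\<close>
  then have "\<not> bar x \<sqsubseteq> bar (bar y)" by (simp add: bar_le_iff le_bar_iff)
  then have "padd (bar x) (bar y) = None" using add_defined_iff by blast
  with False show ?thesis by (simp add: pea_odot_def)
qed (simp add: pea_odot_def)

lemma pea_odot_defined_iff: "pea_odot padd bar tilde x y \<noteq> None \<longleftrightarrow> tilde x \<sqsubseteq> y"
  using add_defined_iff[of "bar x" "bar y"] by (simp add: pea_odot_eq bar_le_iff le_bar_iff)

text \<open>Reassociating \<open>bar u\<close> + (\<open>bar y\<close> + \<open>v\<close>) =
  \<open>one\<close> identifies \<open>bar u\<close> + \<open>bar y\<close> as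
  \<open>bar v\<close>.\<close>

lemma pea_odot_add_left:
  assumes "padd (bar y) v = Some u"
  shows "pea_odot padd bar tilde u y = Some v"
proof -
  obtain s where "padd (bar u) (bar y) = Some s" "padd s v = Some one"
    using assocD2[OF assms bar_add] by blast
  then show ?thesis by (simp add: pea_odot_eq P3_bar)
qed

lemma add_pea_odot_left:
  assumes "pea_odot padd bar tilde u y = Some v"
  shows "padd (bar y) v = Some u"
proof -
  obtain s where s: "padd (bar u) (bar y) = Some s" "v = tilde s"
    using assms by (auto simp: pea_odot_eq)
  obtain t where "padd (bar y) v = Some t" "padd (bar u) t = Some one"
    using assocD1[OF s(1) add_tilde] s(2) by blast
  then show ?thesis by (simp add: P3_tilde)
qed

lemma pea_odot_eq_iff: "pea_odot padd bar tilde u y = Some v \<longleftrightarrow> padd (bar y) v = Some u"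
  using pea_odot_add_left add_pea_odot_left by blast

lemma partial_monoid_pea_odot: "partial_monoid (pea_odot padd bar tilde) one"
proof
  fix x y z
  \<comment> \<open>The \<open>bar\<close> of an outer product cancels the \<open>tilde\<close> of
    an inner one, so both bracketings become \<open>tilde\<close> of a threefold sum of
    complements.\<close>
  have bind_bar: "Option.bind (map_option tilde q) (\<lambda>s. map_option tilde (padd (bar s) r)) =
      map_option tilde (Option.bind q (\<lambda>s. padd s r))"
    and bind_bar': "Option.bind (map_option tilde q) (\<lambda>s. map_option tilde (padd r (bar s))) =
      map_option tilde (Option.bind q (padd r))" for q r
    by (cases q; simp)+
  show "Option.bind (pea_odot padd bar tilde x y) (\<lambda>s. pea_odot padd bar tilde s z) =
      Option.bind (pea_odot padd bar tilde y z) (pea_odot padd bar tilde x)"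
    unfolding pea_odot_eq by (simp only: bind_bar bind_bar' P2)
qed (simp_all add: pea_odot_eq add_zero zero_add)

text \<open>Under \<open>bar\<close> the element \<open>y\<close> gives the smaller summand, so its
  sum exists once that of \<open>x\<close> does; \<open>tilde\<close> reverses the order
  back.\<close>

lemma pea_odot_mono_left:
  assumes "bar z \<sqsubseteq> x" "x \<sqsubseteq> y"
  shows "\<exists>u v. pea_odot padd bar tilde x z = Some u \<and> pea_odot padd bar tilde y z = Some v \<and> u \<sqsubseteq> v"
proof -
  obtain t where t: "padd (bar x) (bar z) = Some t"
    using assms(1) add_defined_iff[of "bar x" "bar z"] by (auto simp: bar_antitone)
  then obtain s where "padd (bar y) (bar z) = Some s" "s \<sqsubseteq> t"
    using bar_antitone[OF assms(2)] by (metis add_mono_left)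
  with t show ?thesis by (simp add: pea_odot_eq tilde_antitone)
qed

lemma pea_odot_mono_right:
  assumes "tilde z \<sqsubseteq> x" "x \<sqsubseteq> y"
  shows "\<exists>u v. pea_odot padd bar tilde z x = Some u \<and> pea_odot padd bar tilde z y = Some v \<and> u \<sqsubseteq> v"
proof -
  obtain t where t: "padd (bar z) (bar x) = Some t"
    using assms(1) add_defined_iff[of "bar z" "bar x"] by (auto simp: bar_antitone bar_le_iff)
  then obtain s where "padd (bar z) (bar y) = Some s" "s \<sqsubseteq> t"
    using bar_antitone[OF assms(2)] by (metis add_mono_right)
  with t show ?thesis by (simp add: pea_odot_eq tilde_antitone)
qed

section \<open>The residual and divisibility\<close>

lemma lower_zero: "lower le {x, zero} = {zero}"
  using zero_le le_antisym by (auto simp: lower_def)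

lemma lower_le: "x \<sqsubseteq> y \<Longrightarrow> lower le {y, x} = lower le {x}"
  using le_trans by (auto simp: lower_def)

lemma pea_imp_zero: "pea_imp padd bar x zero = {bar x}"
  by (auto simp: pea_imp_def lower_zero set_op_right_def add_zero)

text \<open>Each \<open>v\<close> below \<open>y\<close> has a sum \<open>bar y\<close> +
  \<open>v\<close>, and cancellation recovers \<open>v\<close> from it. For \<open>z\<close> below
  \<open>y\<close> this is divisibility.\<close>

lemma set_op_left_pea_imp: "set_op_left (pea_odot padd bar tilde) (pea_imp padd bar y z) y =
    lower le {y, z}"
proof -
  have "\<exists>u. padd (bar y) v = Some u" if "v \<sqsubseteq> y" for v
    using that add_defined_iff[of "bar y" v] by (simp add: le_bar_iff)
  then have "v \<in> set_op_left (pea_odot padd bar tilde) (pea_imp padd bar y z) y"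
    if "v \<in> lower le {y, z}" for v
    using that unfolding set_op_left_def set_op_right_def pea_imp_def pea_odot_eq_iff lower_def
    by blast
  then show ?thesis
    by (auto simp: set_op_left_def set_op_right_def pea_imp_def pea_odot_eq_iff
        dest: add_cancel_left)
qed

lemma pea_imp_defined: "u \<in> pea_imp padd bar y z \<Longrightarrow> pea_odot padd bar tilde u y \<noteq> None"
  by (auto simp: pea_imp_def set_op_right_def pea_odot_add_left)

text \<open>An element above \<open>bar y\<close> is some \<open>bar y\<close> + \<open>v\<close> by
  definition of the order, and \<open>v\<close> is its product with \<open>y\<close>.\<close>

lemma set_op_right_bar_pea_odot:
  assumes "\<And>u. u \<in> A \<Longrightarrow> bar y \<sqsubseteq> u"
  shows "set_op_right padd (bar y) (set_op_left (pea_odot padd bar tilde) A y) = A"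
proof -
  have "\<exists>v. padd (bar y) v = Some u" if "u \<in> A" for u
    using assms[OF that] unfolding induced_le_def .
  then show ?thesis
    by (fastforce simp: set_op_right_def set_op_left_def pea_odot_eq_iff)
qed

section \<open>De Morgan laws for lower and upper sets\<close>

lemma lower_bar_image: "lower le (bar ` A) = bar ` upper le A"
proof -
  have "x \<in> bar ` upper le A" if "x \<in> lower le (bar ` A)" for x
    using that by (intro image_eqI[of _ _ "tilde x"]) (auto simp: lower_def upper_def le_bar_iff)
  then show ?thesis by (auto simp: lower_def upper_def bar_antitone)
qed

lemma upper_bar_image: "upper le (bar ` A) = bar ` lower le A"
proof -
  have "x \<in> bar ` lower le A" if "x \<in> upper le (bar ` A)" for x
    using that by (intro image_eqI[of _ _ "tilde x"]) (auto simp: lower_def upper_def bar_le_iff)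
  then show ?thesis by (auto simp: lower_def upper_def bar_antitone)
qed

lemma set_le_bar_image: "set_le le (bar ` A) (bar ` B) \<longleftrightarrow> set_le le B A"
  by (auto simp: set_le_def bar_antitone bar_le_iff)

text \<open>\<open>bar\<close> undoes the outer \<open>tilde\<close> of the product; this lets
  monotonicity of the sum speak about products.\<close>

lemma set_op_left_bar_image:
  "set_op_left padd (bar ` A) (bar y) = bar ` set_op_left (pea_odot padd bar tilde) A y"
  by (force simp: set_op_left_def pea_odot_eq image_iff)

end

locale good_monotonous_pseudoeffect_algebra = pseudoeffect_algebra +
  assumes good: "good padd bar tilde"
    and monotonous: "monotonous padd bar tilde"
begin

section \<open>Consequences of goodness and monotonicity\<close>

lemma monotonous_left:
  assumes "A \<noteq> {}" "B \<noteq> {}" "\<And>a. a \<in> A \<union> B \<Longrightarrow> a \<sqsubseteq> bar x"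
    and "set_le le (lower le A) (upper le B)"
  shows "set_le le (lower le (set_op_left padd A x)) (upper le (set_op_left padd B x))"
proof -
  have "set_le le (A \<union> B) {bar x}" using assms(3) by (simp add: set_le_def)
  then show ?thesis using monotonous assms(1,2,4) unfolding monotonous_def Let_def by blast
qed

lemma monotonous_right:
  assumes "A \<noteq> {}" "B \<noteq> {}" "\<And>a. a \<in> A \<union> B \<Longrightarrow> a \<sqsubseteq> tilde x"
    and "set_le le (lower le A) (upper le B)"
  shows "set_le le (lower le (set_op_right padd x A)) (upper le (set_op_right padd x B))"
proof -
  have "set_le le (A \<union> B) {tilde x}" using assms(3) by (simp add: set_le_def)
  then show ?thesis using monotonous assms(1,2,4) unfolding monotonous_def Let_def by blast
qed

lemma good_eq: "map_option tilde (padd (bar x) (bar y)) = map_option bar (padd (tilde x) (tilde y))"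
proof (cases "tilde x \<sqsubseteq> y")
  case True
  then show ?thesis using good by (simp add: good_def)
next
  case False
  \<comment> \<open>Here \<open>good\<close> says nothing, but both sums are undefined.\<close>
  then have "padd (bar x) (bar y) = None" "padd (tilde x) (tilde y) = None"
    using add_defined_iff[of "bar x" "bar y"] add_defined_iff[of "tilde x" "tilde y"]
    by (simp_all add: bar_le_iff le_bar_iff)
  then show ?thesis by simp
qed

lemma dual_good_monotonous:
  "good_monotonous_pseudoeffect_algebra (\<lambda>x y. padd y x) tilde bar zero one"
proof -
  have "good (\<lambda>x y. padd y x) tilde bar"
    by (simp add: good_def good_eq)
  moreover have "monotonous (\<lambda>x y. padd y x) tilde bar"
  proof -
    have swap: "set_op_left (\<lambda>x y. padd y x) A x = set_op_right padd x A"
      "set_op_right (\<lambda>x y. padd y x) x A = set_op_left padd A x" for A x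
      by (simp_all add: set_op_left_def set_op_right_def)
    show ?thesis
      using monotonous unfolding monotonous_def Let_def induced_le_dual swap by blast
  qed
  ultimately show ?thesis
    using dual by (simp add: good_monotonous_pseudoeffect_algebra_def
        good_monotonous_pseudoeffect_algebra_axioms_def)
qed

text \<open>The dual product is \<open>bar\<close> of \<open>tilde y\<close> +
  \<open>tilde x\<close>, which goodness equates with \<open>tilde\<close> of \<open>bar y\<close> +
  \<open>bar x\<close>.\<close>

lemma pea_odot_dual: "pea_odot (\<lambda>x y. padd y x) tilde bar x y = pea_odot padd bar tilde y x"
  using pseudoeffect_algebra.pea_odot_eq[OF dual] by (simp add: pea_odot_eq good_eq)

lemma pea_odot_bar_tilde:
  "map_option tilde (pea_odot padd bar tilde (bar x) (bar y)) =
   map_option bar (pea_odot padd bar tilde (tilde x) (tilde y))"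
proof -
  \<comment> \<open>Goodness supplies an outer \<open>bar\<close> for the next \<open>tilde\<close>
    to cancel; both sides then equal \<open>padd x y\<close>.\<close>
  have "pea_odot padd bar tilde (bar x) (bar y) = map_option bar (padd x y)"
    by (simp add: pea_odot_eq good_eq)
  then show ?thesis by (simp add: pea_odot_eq option.map_comp comp_def)
qed

lemma pea_odot_transport:
  assumes "A \<noteq> {}" "B \<noteq> {}" "\<And>u. u \<in> A \<union> B \<Longrightarrow> bar y \<sqsubseteq> u"
    and "set_le le (lower le A) (upper le B)"
  shows "set_le le (lower le (set_op_left (pea_odot padd bar tilde) A y))
    (upper le (set_op_left (pea_odot padd bar tilde) B y))"
proof -
  \<comment> \<open>\<open>bar\<close> exchanges lower and upper sets and reverses
    \<open>set_le\<close>, so \<open>A\<close> and \<open>B\<close> change places.\<close>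
  have "set_le le (lower le (bar ` B)) (upper le (bar ` A))"
    using assms(4) by (simp add: lower_bar_image upper_bar_image set_le_bar_image)
  then have "set_le le (lower le (set_op_left padd (bar ` B) (bar y)))
      (upper le (set_op_left padd (bar ` A) (bar y)))"
    using assms(1-3) by (intro monotonous_left) (auto simp: bar_antitone)
  then show ?thesis
    by (simp add: set_op_left_bar_image lower_bar_image upper_bar_image set_le_bar_image)
qed

lemma residuation:
  "set_le le (lower le (set_op_left (pea_odot padd bar tilde) (upper le {x, bar y}) y))
     (upper le (lower le {y, z})) \<longleftrightarrow>
   set_le le (lower le (upper le {x, bar y})) (upper le (pea_imp padd bar y z))"
  (is "set_le le (lower le ?M) (upper le ?N) \<longleftrightarrow> set_le le (lower le ?V) (upper le ?I)")
proof
  \<comment> \<open>Monotonicity asks for nonempty sets: \<open>one\<close> provides for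
    \<open>?V\<close> and \<open>?M\<close>, \<open>zero\<close> for \<open>?N\<close> and
    \<open>?I\<close>.\<close>
  have V: "one \<in> ?V" "\<And>u. u \<in> ?V \<Longrightarrow> bar y \<sqsubseteq> u"
    by (auto simp: upper_def le_one)
  have N: "zero \<in> ?N"
    by (auto simp: lower_def zero_le)
  have I: "?I = set_op_right padd (bar y) ?N"
    by (simp add: pea_imp_def)
  have M_ne: "?M \<noteq> {}"
    using V(1) pea_odot_defined_iff[of one y] by (auto simp: set_op_left_def zero_le)
  have I_ne: "?I \<noteq> {}"
    using N add_zero unfolding I set_op_right_def by blast
  have M_le: "v \<sqsubseteq> y" if "v \<in> ?M" for v
    using that add_defined_iff[of "bar y" v]
    by (auto simp: set_op_left_def pea_odot_eq_iff le_bar_iff)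
  have I_ge: "bar y \<sqsubseteq> u" if "u \<in> ?I" for u
    using that unfolding I set_op_right_def induced_le_def by blast
  show "set_le le (lower le ?V) (upper le ?I)" if "set_le le (lower le ?M) (upper le ?N)"
  proof -
    \<comment> \<open>Adding \<open>bar y\<close> is allowed because \<open>?M\<close> and
      \<open>?N\<close> lie below \<open>y\<close>, the \<open>tilde\<close> of
      \<open>bar y\<close>; it carries \<open>?M\<close> back to \<open>?V\<close>.\<close>
    have "set_le le (lower le (set_op_right padd (bar y) ?M))
        (upper le (set_op_right padd (bar y) ?N))"
      using that N M_ne M_le by (intro monotonous_right) (auto simp: lower_def)
    moreover have "set_op_right padd (bar y) ?M = ?V"
      using V(2) by (rule set_op_right_bar_pea_odot)
    ultimately show ?thesis by (simp only: I)
  qed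
  show "set_le le (lower le ?M) (upper le ?N)" if "set_le le (lower le ?V) (upper le ?I)"
  proof -
    \<comment> \<open>Multiplication by \<open>y\<close> takes \<open>?V\<close> to
      \<open>?M\<close> and \<open>?I\<close> exactly onto \<open>?N\<close>.\<close>
    have "set_le le (lower le ?M) (upper le (set_op_left (pea_odot padd bar tilde) ?I y))"
      using that V I_ne I_ge by (intro pea_odot_transport) auto
    then show ?thesis unfolding set_op_left_pea_imp .
  qed
qed

end

theorem theorem4:
  fixes padd :: "'a \<Rightarrow> 'a \<Rightarrow> 'a option"
    and bar tilde :: "'a \<Rightarrow> 'a"
    and zero one :: 'a
  assumes "pseudoeffect_algebra padd bar tilde zero one"
    and "good padd bar tilde"
    and "monotonous padd bar tilde"
  shows "divisible_unsharp_residuated_poset (induced_le padd) (pea_odot padd bar tilde)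
    (pea_imp padd bar) (pea_limp padd tilde) bar tilde zero one"
proof -
  interpret good_monotonous_pseudoeffect_algebra padd bar tilde zero one
    using assms by (simp add: good_monotonous_pseudoeffect_algebra_def
        good_monotonous_pseudoeffect_algebra_axioms_def)
  interpret D: good_monotonous_pseudoeffect_algebra "\<lambda>x y. padd y x" tilde bar zero one
    by (rule dual_good_monotonous)
  have imp_dual: "pea_imp (\<lambda>x y. padd y x) tilde = pea_limp padd tilde"
    by (simp add: fun_eq_iff pea_imp_def pea_limp_def induced_le_dual
        set_op_left_def set_op_right_def)
  have op_dual: "set_op_left (pea_odot (\<lambda>x y. padd y x) tilde bar) A y =
      set_op_right (pea_odot padd bar tilde) y A" for A y
    by (simp add: set_op_left_def set_op_right_def pea_odot_dual)
  \<comment> \<open>These equations translate each fact of \<open>D\<close> on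
    \<open>pea_imp\<close> into one on \<open>pea_limp\<close>, with the factors of the product
    exchanged.\<close>
  note duals = induced_le_dual imp_dual op_dual pea_odot_dual
  show ?thesis
  proof (intro divisible_unsharp_residuated_poset.intro unsharp_residuated_poset.intro
      divisible_unsharp_residuated_poset_axioms.intro)
    show "reflp (induced_le padd)" "antisymp (induced_le padd)" "transp (induced_le padd)"
      using le_refl le_antisym le_trans by (auto intro: reflpI antisympI transpI)
    show "partial_monoid (pea_odot padd bar tilde) one"
      by (rule partial_monoid_pea_odot)
  next
    fix x y
    assume "induced_le padd x y"
    then show "set_op_left (pea_odot padd bar tilde) (pea_imp padd bar y x) y =
        lower (induced_le padd) {x}"
      "set_op_right (pea_odot padd bar tilde) y (pea_limp padd tilde y x) =
        lower (induced_le padd) {x}"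
      using set_op_left_pea_imp D.set_op_left_pea_imp[unfolded duals] lower_le by simp_all
  qed (use zero_le le_one bar_antitone tilde_antitone pea_odot_defined_iff
      pea_odot_mono_left pea_odot_mono_right residuation D.residuation[unfolded duals]
      pea_imp_zero D.pea_imp_zero[unfolded duals] pea_odot_bar_tilde pea_imp_defined
      D.pea_imp_defined[unfolded duals] in \<open>simp_all\<close>)
qed

end
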